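(* Let $1\le p<\infty$ and let $\{X_n\}_{n=1}^\infty$ and $\{Y_n\}_{n=1}^\infty$ be sequences of nonempty metric spaces such that $\sum_{n=1}^\infty(\operatorname{diam}(X_n))^p<\infty$ and $\sum_{n=1}^\infty(\operatorname{diam}(Y_n))^p<\infty$. Then $$\sup_{n}\Biggl(d_{GH}(X_n,Y_n)-\frac12\Bigl(\sum_{m\ne n}(\operatorname{diam}(X_m))^p\Bigr)^{1/p}-\frac12\Bigl(\sum_{m\ne n}(\operatorname{diam}(Y_m))^p\Bigr)^{1/p}\Biggr)\le d_{GH}\Bigl((l^p)\prod_{n}X_n,\ (l^p)\prod_nY_n\Bigr)$$ and $$d_{GH}\Bigl((l^p)\prod_{n}X_n,\ (l^p)\prod_nY_n\Bigr)\le\Bigl(\sum_{n=1}^\infty\bigl(d_{GH}(X_n,Y_n)\bigr)^p\Bigr)^{1/p}.$$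
   Context: $\operatorname{diam}(X)=\sup_{x,y\in X}d_X(x,y)$. A correspondence between metric spaces $X$ and $Y$ is a subset $R\subset X\times Y$ whose projections to $X$ and to $Y$ are surjective; $\mathcal R(X,Y)$ is the set of all correspondences. Its distortion is $\operatorname{dis}R=\sup\{|d_X(x,x')-d_Y(y,y')| : (x,y),(x',y')\in R\}$. The Gromov--Hausdorff distance is $d_{GH}(X,Y)=\frac12\inf\{\operatorname{dis}R: R\in\mathcal R(X,Y)\}$. For a sequence $\{(X_n,d_n)\}_{n=1}^\infty$ of metric spaces with $\sum_n(\operatorname{diam}(X_n))^p<\infty$, the $l^p$-product $(l^p)\prod_nX_n$ is the Cartesian product $\prod_{n=1}^\infty X_n$ with metric $d(\{x_n\},\{y_n\})=\bigl(\sum_{n=1}^\infty d_n(x_n,y_n)^p\bigr)^{1/p}$. *)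

theory Defs
  imports "HOL-Analysis.Analysis"
begin

text \<open>
  Metric spaces are carrier/distance pairs satisfying \<open>Metric_space\<close>.  Diameter, distortion and
  Gromov--Hausdorff distance take values in the extended reals, so that no boundedness is built
  into the definitions.
\<close>

definition ediam :: "'a set \<Rightarrow> ('a \<Rightarrow> 'a \<Rightarrow> real) \<Rightarrow> ereal" where
  "ediam M d = (SUP (x, y) \<in> M \<times> M. ereal (d x y))"

definition correspondences :: "'a set \<Rightarrow> 'b set \<Rightarrow> ('a \<times> 'b) set set" where
  "correspondences M N = {R. R \<subseteq> M \<times> N \<and> fst ` R = M \<and> snd ` R = N}"

definition distortion ::
    "('a \<Rightarrow> 'a \<Rightarrow> real) \<Rightarrow> ('b \<Rightarrow> 'b \<Rightarrow> real) \<Rightarrow> ('a \<times> 'b) set \<Rightarrow> ereal" where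
  "distortion d e R = (SUP ((x, y), (x', y')) \<in> R \<times> R. ereal \<bar>d x x' - e y y'\<bar>)"

definition GH_dist ::
    "'a set \<Rightarrow> ('a \<Rightarrow> 'a \<Rightarrow> real) \<Rightarrow> 'b set \<Rightarrow> ('b \<Rightarrow> 'b \<Rightarrow> real) \<Rightarrow> ereal" where
  "GH_dist M d N e = ereal (1/2) * (INF R \<in> correspondences M N. distortion d e R)"

text \<open>Real powers on \<open>[0, \<infinity>]\<close>, for exponents \<open>p > 0\<close>; the values at negative arguments
  are irrelevant.\<close>

definition ereal_powr :: "ereal \<Rightarrow> real \<Rightarrow> ereal" where
  "ereal_powr x p = (if x = \<infinity> then \<infinity> else ereal (real_of_ereal x powr p))"

text \<open>The \<open>l\<^sup>p\<close>-product of a sequence of metric spaces, indexed from \<open>0\<close>.  The series in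
  \<open>lp_dist\<close> is real-valued; it converges on \<open>lp_carrier\<close> if the \<open>p\<close>-th powers of the
  diameters are summable, which is the only case in which the product is defined.\<close>

definition lp_carrier :: "(nat \<Rightarrow> 'a set) \<Rightarrow> (nat \<Rightarrow> 'a) set" where
  "lp_carrier X = (\<Pi> n \<in> UNIV. X n)"

definition lp_dist ::
    "real \<Rightarrow> (nat \<Rightarrow> 'a \<Rightarrow> 'a \<Rightarrow> real) \<Rightarrow> (nat \<Rightarrow> 'a) \<Rightarrow> (nat \<Rightarrow> 'a) \<Rightarrow> real" where
  "lp_dist p d x y = (\<Sum>n. d n (x n) (y n) powr p) powr (1 / p)"

end

theory Submission
  imports Defs
begin

text \<open>
  Both bounds compare correspondences of the products with correspondences of the factors, and
  both rest on Minkowski's inequality for sequences, \<open>minkowski_lp_norm\<close>.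

  Lower bound.  Fix an index \<open>n\<close>.  On \<open>(l\<^sup>p)\<Prod>X\<^sub>m\<close> the distance of two points is at
  least the distance of their \<open>n\<close>-th coordinates, and by Minkowski it exceeds that distance by
  at most the \<open>l\<^sup>p\<close>-norm of the diameters of the other factors (\<open>lp_dist_le_coordinate_plus\<close>).
  Projecting a correspondence of the products to the \<open>n\<close>-th coordinates thus gives a
  correspondence of \<open>X\<^sub>n\<close> and \<open>Y\<^sub>n\<close> whose distortion has grown by at most the two norms of
  remaining diameters; these are the subtracted terms (\<open>GH_dist_factor_le\<close>).

  Upper bound.  If \<open>R\<^sub>n\<close> is a correspondence of \<open>X\<^sub>n\<close> and \<open>Y\<^sub>n\<close> with distortion at most
  \<open>2r\<^sub>n\<close>, then the coordinatewise product of the \<open>R\<^sub>n\<close> is a correspondence of the products.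
  The two distance sequences of a pair of related points differ by at most \<open>2r\<^sub>n\<close> in the \<open>n\<close>-th
  place, so by Minkowski its distortion is at most \<open>2 \<parallel>r\<parallel>\<^sub>p\<close>.  The infimum defining the
  Gromov--Hausdorff distance \<open>g\<^sub>n\<close> need not be attained, so one takes \<open>r\<^sub>n = g\<^sub>n + \<delta> / 2\<^sup>n\<close>.
  Minkowski once more gives \<open>\<parallel>r\<parallel>\<^sub>p \<le> \<parallel>g\<parallel>\<^sub>p + O(\<delta>)\<close>, and \<open>\<delta>\<close> tends to \<open>0\<close>
  (\<open>GH_dist_product_le\<close>).  If the series of the \<open>g\<^sub>n\<^sup>p\<close> diverges, the bound is trivial.
\<close>

section \<open>Minkowski's inequality for sequences\<close>

definition lp_norm :: "real \<Rightarrow> (nat \<Rightarrow> real) \<Rightarrow> real" where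
  "lp_norm p a = (\<Sum>n. a n powr p) powr (1 / p)"

lemma lp_dist_eq_lp_norm: "lp_dist p d x y = lp_norm p (\<lambda>n. d n (x n) (y n))"
  by (simp add: lp_dist_def lp_norm_def)

lemma lp_norm_nonneg [simp]: "0 \<le> lp_norm p a"
  by (simp add: lp_norm_def)

lemma lp_norm_powr:
  assumes "p \<ge> 1" "summable (\<lambda>n. a n powr p)"
  shows "lp_norm p a powr p = (\<Sum>n. a n powr p)"
  using assms by (simp add: lp_norm_def powr_powr suminf_nonneg)

lemma summable_powr_mono:
  fixes a b :: "nat \<Rightarrow> real"
  assumes "p \<ge> 1" "\<And>n. 0 \<le> a n" "\<And>n. a n \<le> b n" "summable (\<lambda>n. b n powr p)"
  shows "summable (\<lambda>n. a n powr p)"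
  using assms(4)
  by (rule summable_comparison_test') (use assms in \<open>auto intro!: powr_mono2\<close>)

lemma lp_norm_mono:
  assumes "p \<ge> 1" "\<And>n. 0 \<le> a n" "\<And>n. a n \<le> b n" "summable (\<lambda>n. b n powr p)"
  shows "lp_norm p a \<le> lp_norm p b"
  unfolding lp_norm_def
proof (rule powr_mono2)
  have "summable (\<lambda>n. a n powr p)"
    using assms by (rule summable_powr_mono)
  then show "(\<Sum>n. a n powr p) \<le> (\<Sum>n. b n powr p)" "0 \<le> (\<Sum>n. a n powr p)"
    using assms by (auto intro!: suminf_le powr_mono2 suminf_nonneg)
qed (use assms in auto)

lemma lp_norm_scale:
  assumes "p \<ge> 1" "0 \<le> c" "\<And>n. 0 \<le> a n" "summable (\<lambda>n. a n powr p)"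
  shows "summable (\<lambda>n. (c * a n) powr p)" "lp_norm p (\<lambda>n. c * a n) = c * lp_norm p a"
proof -
  have *: "(c * a n) powr p = c powr p * a n powr p" for n
    using assms by (simp add: powr_mult)
  show "summable (\<lambda>n. (c * a n) powr p)"
    unfolding * using assms by (intro summable_mult)
  show "lp_norm p (\<lambda>n. c * a n) = c * lp_norm p a"
    unfolding lp_norm_def * using assms
    by (simp add: suminf_mult powr_mult powr_powr suminf_nonneg)
qed

lemma coordinate_le_lp_norm:
  assumes "p \<ge> 1" "\<And>n. 0 \<le> a n" "summable (\<lambda>n. a n powr p)"
  shows "a n \<le> lp_norm p a"
proof -
  have "a n powr p \<le> (\<Sum>n. a n powr p)"
    using sum_le_suminf[of "\<lambda>n. a n powr p" "{n}"] assms by auto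
  then have "(a n powr p) powr (1/p) \<le> lp_norm p a"
    unfolding lp_norm_def using assms by (intro powr_mono2) auto
  then show ?thesis using assms by (simp add: powr_powr)
qed

lemma lp_norm_single:
  assumes "p \<ge> 1" "0 \<le> c"
  shows "summable (\<lambda>m. (if m = n then c else 0) powr p)"
    "lp_norm p (\<lambda>m. if m = n then c else 0) = c"
proof -
  have "(\<lambda>m. (if m = n then c else 0) powr p) = (\<lambda>m. if m = n then c powr p else 0)"
    using assms by auto
  moreover have "(\<lambda>m. if m = n then c powr p else 0) sums (c powr p)"
    using sums_single[of n "\<lambda>_. c powr p"] by simp
  ultimately show "summable (\<lambda>m. (if m = n then c else 0) powr p)"
    "lp_norm p (\<lambda>m. if m = n then c else 0) = c"
    using assms by (auto simp: lp_norm_def sums_iff powr_powr)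
qed

text \<open>Zero distances occur, so the endpoint \<open>0\<close> is included.  There the claim reduces to
  \<open>s powr p \<le> s\<close> for \<open>0 \<le> s \<le> 1\<close>; inside the half-line it is \<open>powr_convex\<close>.\<close>

lemma powr_convex_nonneg:
  fixes x y s t :: real
  assumes "p \<ge> 1" "0 \<le> x" "0 \<le> y" "0 \<le> s" "0 \<le> t" "s + t = 1"
  shows "(s * x + t * y) powr p \<le> s * x powr p + t * y powr p"
proof -
  have shrink: "(u * z) powr p \<le> u * z powr p" if "0 \<le> u" "u \<le> 1" "0 \<le> z" for u z :: real
  proof -
    have "u powr p \<le> u"
      using powr_mono'[of 1 p u] that assms by (cases "u = 0") auto
    then show ?thesis
      using that by (simp add: powr_mult mult_right_mono)
  qed
  consider "x = 0" | "y = 0" | "x > 0" "y > 0" using assms by linarith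
  then show ?thesis
  proof cases
    case 1
    then show ?thesis using shrink[of t y] assms by simp
  next
    case 2
    then show ?thesis using shrink[of s x] assms by simp
  next
    case 3
    then show ?thesis
      using convex_onD[OF powr_convex[OF assms(1)], of t x y] assms(4-6)
      by (simp add: eq_diff_eq[symmetric])
  qed
qed

lemma lp_norm_eq_0D:
  assumes "p \<ge> 1" "\<And>n. 0 \<le> a n" "summable (\<lambda>n. a n powr p)" "lp_norm p a = 0"
  shows "a n = 0"
  using coordinate_le_lp_norm[OF assms(1-3), of n] assms(2)[of n] assms(4) by simp

text \<open>With \<open>A\<close> and \<open>B\<close> the two norms, the sequence \<open>a + b\<close> is \<open>A + B\<close> times the convex
  combination, with weights \<open>A / (A + B)\<close> and \<open>B / (A + B)\<close>, of the unit vectors \<open>a / A\<close> and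
  \<open>b / B\<close>.  Convexity of \<open>t powr p\<close> in every coordinate bounds \<open>(a + b) powr p\<close> by a sequence
  with sum \<open>(A + B) powr p\<close>, which yields convergence and the inequality at once.\<close>

lemma minkowski_lp_norm:
  assumes p: "p \<ge> 1" and a: "\<And>n. 0 \<le> a n" "summable (\<lambda>n. a n powr p)"
    and b: "\<And>n. 0 \<le> b n" "summable (\<lambda>n. b n powr p)"
  shows "summable (\<lambda>n. (a n + b n) powr p)"
    and "lp_norm p (\<lambda>n. a n + b n) \<le> lp_norm p a + lp_norm p b"
proof -
  define A B where "A = lp_norm p a" and "B = lp_norm p b"
  have "summable (\<lambda>n. (a n + b n) powr p) \<and> lp_norm p (\<lambda>n. a n + b n) \<le> A + B"
  proof (cases "A = 0 \<or> B = 0")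
    case True
    then consider "\<And>n. a n = 0" | "\<And>n. b n = 0"
      using lp_norm_eq_0D[OF p a] lp_norm_eq_0D[OF p b] unfolding A_def B_def by blast
    then show ?thesis
      using a b by cases (simp_all add: A_def B_def)
  next
    case False
    then have pos: "A > 0" "B > 0"
      using lp_norm_nonneg[of p a] lp_norm_nonneg[of p b] unfolding A_def B_def by linarith+
    define C where "C = A + B"
    have C: "C > 0" using pos by (simp add: C_def)
    have Ap: "A powr p = (\<Sum>n. a n powr p)" and Bp: "B powr p = (\<Sum>n. b n powr p)"
      using lp_norm_powr[OF p] a b by (auto simp: A_def B_def)
    define f where "f n = C powr p * (A / C * (a n powr p / A powr p) +
        B / C * (b n powr p / B powr p))" for n
    have le: "(a n + b n) powr p \<le> f n" for n
    proof -
      have "a n + b n = C * (A / C * (a n / A) + B / C * (b n / B))"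
        using pos C by (simp add: field_simps)
      then have "(a n + b n) powr p =
          C powr p * (A / C * (a n / A) + B / C * (b n / B)) powr p"
        using pos C a b by (simp add: powr_mult)
      also have "\<dots> \<le> C powr p * (A / C * (a n / A) powr p + B / C * (b n / B) powr p)"
        using pos C a b p by (intro mult_left_mono powr_convex_nonneg)
          (auto simp: C_def add_divide_distrib[symmetric])
      finally show ?thesis using pos a b by (simp add: f_def powr_divide)
    qed
    have "(\<lambda>n. A / C * (a n powr p / A powr p) + B / C * (b n powr p / B powr p)) sums
        (A / C * (A powr p / A powr p) + B / C * (B powr p / B powr p))"
      using a b unfolding Ap Bp
      by (intro sums_add sums_mult sums_divide summable_sums)
    moreover have "A / C * (A powr p / A powr p) + B / C * (B powr p / B powr p) = 1"
      using pos C by (simp add: C_def add_divide_distrib[symmetric])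
    ultimately have f: "f sums (C powr p)"
      unfolding f_def using sums_mult[of _ 1 "C powr p"] by simp
    have summ: "summable (\<lambda>n. (a n + b n) powr p)"
      by (rule summable_comparison_test'[OF sums_summable[OF f]]) (use le in auto)
    have "(\<Sum>n. (a n + b n) powr p) \<le> C powr p"
      using suminf_le[OF le summ sums_summable[OF f]] sums_unique[OF f] by simp
    then have "lp_norm p (\<lambda>n. a n + b n) \<le> (C powr p) powr (1/p)"
      unfolding lp_norm_def using p summ by (intro powr_mono2) (auto intro: suminf_nonneg)
    then show ?thesis
      using summ p C by (simp add: powr_powr C_def)
  qed
  then show "summable (\<lambda>n. (a n + b n) powr p)"
    "lp_norm p (\<lambda>n. a n + b n) \<le> lp_norm p a + lp_norm p b"
    by (auto simp: A_def B_def)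
qed

lemma lp_norm_triangle_le:
  assumes "p \<ge> 1" "\<And>n. 0 \<le> a n" "summable (\<lambda>n. a n powr p)"
    and "\<And>n. 0 \<le> b n" "summable (\<lambda>n. b n powr p)"
    and "\<And>n. 0 \<le> c n" "\<And>n. c n \<le> a n + b n"
  shows "lp_norm p c \<le> lp_norm p a + lp_norm p b"
  using lp_norm_mono[OF assms(1,6,7) minkowski_lp_norm(1)[OF assms(1-5)]]
    minkowski_lp_norm(2)[OF assms(1-5)] by linarith

section \<open>Series of extended real powers\<close>

lemma ereal_powr_ereal [simp]: "ereal_powr (ereal x) p = ereal (x powr p)"
  by (simp add: ereal_powr_def)

lemma ereal_powr_infinity: "ereal_powr \<infinity> p = \<infinity>"
  by (simp add: ereal_powr_def)

lemma suminf_ereal_powr: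
  assumes "summable (\<lambda>n. a n powr p)"
  shows "(\<Sum>n. ereal_powr (ereal (a n)) p) = ereal (\<Sum>n. a n powr p)"
  using suminf_ereal'[OF assms] by simp

text \<open>A finite sum of nonnegative terms has only finite terms, so under the hypotheses on the
  diameters everything takes place in the reals.\<close>

lemma finite_ereal_powr_seriesE:
  fixes f :: "nat \<Rightarrow> ereal"
  assumes "\<And>n. 0 \<le> f n" "(\<Sum>n. ereal_powr (f n) p) < \<infinity>"
  obtains a where "\<And>n. f n = ereal (a n)" "\<And>n. 0 \<le> a n" "summable (\<lambda>n. a n powr p)"
proof
  have nonneg: "0 \<le> ereal_powr (f n) p" for n
    by (simp add: ereal_powr_def)
  have "ereal_powr (f n) p \<noteq> \<infinity>" for n
    using suminf_PInfty[OF nonneg] assms(2) by simp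
  then have "f n \<noteq> \<infinity>" for n
    by (metis ereal_powr_def)
  then show eq: "f n = ereal (real_of_ereal (f n))" for n
    using assms(1)[of n] by (cases "f n") auto
  show "0 \<le> real_of_ereal (f n)" for n
    using assms(1) by (simp add: real_of_ereal_pos)
  have "(\<Sum>n. ereal_powr (f n) p) = (\<Sum>n. ereal (real_of_ereal (f n) powr p))"
    by (metis eq ereal_powr_ereal)
  then show "summable (\<lambda>n. real_of_ereal (f n) powr p)"
    using assms(2) by (intro summable_ereal) auto
qed

section \<open>Diameter, distortion and Gromov--Hausdorff distance\<close>

lemma dist_le_ediam: "x \<in> M \<Longrightarrow> y \<in> M \<Longrightarrow> ereal (d x y) \<le> ediam M d"
  unfolding ediam_def by (rule SUP_upper2[of "(x, y)"]) auto

lemma ediam_nonneg: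
  assumes "Metric_space M d" "M \<noteq> {}"
  shows "0 \<le> ediam M d"
proof -
  obtain x where "x \<in> M" using assms by blast
  then show ?thesis
    using dist_le_ediam[of x M x d] Metric_space.nonneg[OF assms(1), of x x]
    by (metis ereal_less_eq(5) order_trans)
qed

lemma distortion_le_iff:
  "distortion d e R \<le> c \<longleftrightarrow>
     (\<forall>x y x' y'. (x, y) \<in> R \<longrightarrow> (x', y') \<in> R \<longrightarrow> ereal \<bar>d x x' - e y y'\<bar> \<le> c)"
  unfolding distortion_def SUP_le_iff by (simp add: Ball_def split_paired_All) blast

lemma GH_dist_nonneg:
  assumes "M \<noteq> {}"
  shows "0 \<le> GH_dist M d N e"
proof -
  have "0 \<le> distortion d e R" if R: "R \<in> correspondences M N" for R
  proof -
    obtain x y where "(x, y) \<in> R"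
      using R assms unfolding correspondences_def by fastforce
    then have "ereal \<bar>d x x - e y y\<bar> \<le> distortion d e R"
      using distortion_le_iff[of d e R "distortion d e R"] by blast
    then show ?thesis
      by (metis abs_ge_zero ereal_less_eq(5) order_trans)
  qed
  then have "0 \<le> (INF R \<in> correspondences M N. distortion d e R)"
    by (rule INF_greatest)
  then show ?thesis
    unfolding GH_dist_def by simp
qed

text \<open>Apart from nonnegativity, the next two rules carry all that is needed of the definition: a bound on
  \<open>GH_dist\<close> by a real number \<open>c\<close> is the same, up to strictness, as a correspondence with
  real distortion at most \<open>2 * c\<close>.\<close>

lemma GH_dist_leI:
  assumes "R \<in> correspondences M N"
    and "\<And>x y x' y'. (x, y) \<in> R \<Longrightarrow> (x', y') \<in> R \<Longrightarrow> \<bar>d x x' - e y y'\<bar> \<le> 2 * c"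
  shows "GH_dist M d N e \<le> ereal c"
proof -
  have "(INF R \<in> correspondences M N. distortion d e R) \<le> ereal (2 * c)"
    using assms by (intro INF_lower2[of R]) (auto simp: distortion_le_iff)
  then have "GH_dist M d N e \<le> ereal (1/2) * ereal (2 * c)"
    unfolding GH_dist_def by (intro ereal_mult_left_mono) auto
  then show ?thesis by simp
qed

lemma GH_dist_lessE:
  assumes "GH_dist M d N e < ereal c"
  obtains R where "R \<in> correspondences M N"
    and "\<And>x y x' y'. (x, y) \<in> R \<Longrightarrow> (x', y') \<in> R \<Longrightarrow> \<bar>d x x' - e y y'\<bar> \<le> 2 * c"
proof -
  let ?I = "INF R \<in> correspondences M N. distortion d e R"
  have "?I < ereal (2 * c)"
  proof (rule ccontr)
    assume "\<not> ?I < ereal (2 * c)"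
    then have "ereal (1/2) * ereal (2 * c) \<le> ereal (1/2) * ?I"
      by (intro ereal_mult_left_mono) auto
    then show False using assms unfolding GH_dist_def by simp
  qed
  then obtain R where "R \<in> correspondences M N" "distortion d e R < ereal (2 * c)"
    by (auto simp: INF_less_iff)
  then have "\<bar>d x x' - e y y'\<bar> \<le> 2 * c" if "(x, y) \<in> R" "(x', y') \<in> R" for x y x' y'
    using that distortion_le_iff[of d e R "ereal (2 * c)"] by (simp add: less_imp_le)
  with \<open>R \<in> _\<close> show ?thesis using that by blast
qed

section \<open>Correspondences of products\<close>

text \<open>Since no factor is empty, a point of one factor extends to a point of the product.  Hence
  projections of correspondences keep surjective marginals.\<close>

lemma lp_carrier_coordinate:
  assumes "\<And>n. X n \<noteq> {}"
  shows "(\<lambda>x. x n) ` lp_carrier X = X n"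
proof
  show "X n \<subseteq> (\<lambda>x. x n) ` lp_carrier X"
  proof
    fix a assume "a \<in> X n"
    define x where "x m = (if m = n then a else (SOME b. b \<in> X m))" for m
    have "x \<in> lp_carrier X"
      using \<open>a \<in> X n\<close> assms unfolding lp_carrier_def x_def by (auto simp: some_in_eq)
    then show "a \<in> (\<lambda>x. x n) ` lp_carrier X"
      by (rule rev_image_eqI) (simp add: x_def)
  qed
qed (auto simp: lp_carrier_def)

lemma correspondence_project:
  assumes "\<And>n. X n \<noteq> {}" "\<And>n. Y n \<noteq> {}"
    and "R \<in> correspondences (lp_carrier X) (lp_carrier Y)"
  shows "(\<lambda>(x, y). (x n, y n)) ` R \<in> correspondences (X n) (Y n)"
proof -
  have "(\<lambda>x. x n) ` fst ` R = X n" "(\<lambda>y. y n) ` snd ` R = Y n"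
    using assms(3) lp_carrier_coordinate[OF assms(1)] lp_carrier_coordinate[OF assms(2)]
    unfolding correspondences_def by auto
  then show ?thesis
    unfolding correspondences_def by (force simp: image_image case_prod_beta)
qed

lemma correspondence_product:
  assumes "\<And>n. R n \<in> correspondences (X n) (Y n)"
  shows "{(x, y). \<forall>n. (x n, y n) \<in> R n} \<in> correspondences (lp_carrier X) (lp_carrier Y)"
    (is "?P \<in> _")
proof -
  have R: "R n \<subseteq> X n \<times> Y n" "fst ` R n = X n" "snd ` R n = Y n" for n
    using assms[of n] by (auto simp: correspondences_def)
  have "x \<in> fst ` ?P" if "x \<in> lp_carrier X" for x
  proof -
    have "\<exists>b. (x n, b) \<in> R n" for n
      using that R(2)[of n] unfolding lp_carrier_def by fastforce
    then obtain y where "\<And>n. (x n, y n) \<in> R n" by metis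
    then show ?thesis by (intro image_eqI[of _ _ "(x, y)"]) auto
  qed
  moreover have "y \<in> snd ` ?P" if "y \<in> lp_carrier Y" for y
  proof -
    have "\<exists>a. (a, y n) \<in> R n" for n
      using that R(3)[of n] unfolding lp_carrier_def by fastforce
    then obtain x where "\<And>n. (x n, y n) \<in> R n" by metis
    then show ?thesis by (intro image_eqI[of _ _ "(x, y)"]) auto
  qed
  moreover have "?P \<subseteq> lp_carrier X \<times> lp_carrier Y"
    using R(1) by (force simp: lp_carrier_def)
  ultimately show ?thesis
    unfolding correspondences_def by (intro CollectI conjI subset_antisym) fastforce+
qed

section \<open>The two bounds for real diameter sequences\<close>

text \<open>The hypotheses on one of the two sequences of spaces, with real bounds \<open>D\<close> on the diameters;
  the locale is instantiated once for \<open>X\<close> and once for \<open>Y\<close>.\<close>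

locale lp_factors =
  fixes p :: real and X :: "nat \<Rightarrow> 'a set" and d :: "nat \<Rightarrow> 'a \<Rightarrow> 'a \<Rightarrow> real"
    and D :: "nat \<Rightarrow> real"
  assumes p: "1 \<le> p"
    and nonempty: "X n \<noteq> {}"
    and dist_nonneg: "0 \<le> d n a b"
    and dist_le: "a \<in> X n \<Longrightarrow> b \<in> X n \<Longrightarrow> d n a b \<le> D n"
    and summable_diam: "summable (\<lambda>n. D n powr p)"
begin

lemma diam_nonneg: "0 \<le> D n"
  using nonempty[of n] dist_nonneg dist_le order_trans by blast

lemma coordinate_dist_le: "x \<in> lp_carrier X \<Longrightarrow> x' \<in> lp_carrier X \<Longrightarrow> d n (x n) (x' n) \<le> D n"
  by (rule dist_le) (auto simp: lp_carrier_def)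

lemma summable_lp_dist:
  "x \<in> lp_carrier X \<Longrightarrow> x' \<in> lp_carrier X \<Longrightarrow> summable (\<lambda>n. d n (x n) (x' n) powr p)"
  by (rule summable_powr_mono[OF p dist_nonneg coordinate_dist_le summable_diam])

lemma coordinate_le_lp_dist:
  "x \<in> lp_carrier X \<Longrightarrow> x' \<in> lp_carrier X \<Longrightarrow> d n (x n) (x' n) \<le> lp_dist p d x x'"
  unfolding lp_dist_eq_lp_norm
  by (rule coordinate_le_lp_norm[OF p dist_nonneg summable_lp_dist])

lemma summable_remaining: "summable (\<lambda>m. (if m = n then 0 else D m) powr p)"
  by (rule summable_powr_mono[OF p _ _ summable_diam]) (auto simp: diam_nonneg)

text \<open>Minkowski for the splitting of the distance sequence into its \<open>n\<close>-th entry and the rest, which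
  the diameters dominate.\<close>

lemma lp_dist_le_coordinate_plus:
  assumes "x \<in> lp_carrier X" "x' \<in> lp_carrier X"
  shows "lp_dist p d x x' \<le> d n (x n) (x' n) + lp_norm p (\<lambda>m. if m = n then 0 else D m)"
proof -
  have "lp_dist p d x x' \<le> lp_norm p (\<lambda>m. if m = n then d n (x n) (x' n) else 0)
      + lp_norm p (\<lambda>m. if m = n then 0 else D m)"
    unfolding lp_dist_eq_lp_norm
    using assms lp_norm_single(1)[OF p dist_nonneg] summable_remaining
    by (intro lp_norm_triangle_le[OF p]) (auto simp: dist_nonneg diam_nonneg coordinate_dist_le)
  then show ?thesis
    using lp_norm_single(2)[OF p dist_nonneg] by simp
qed

lemma suminf_remaining:
  assumes "\<And>n. ediam (X n) (d n) = ereal (D n)"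
  shows "ereal_powr (\<Sum>m. if m = n then 0 else ereal_powr (ediam (X m) (d m)) p) (1 / p) =
    ereal (lp_norm p (\<lambda>m. if m = n then 0 else D m))"
proof -
  have "(if m = n then 0 else ereal_powr (ediam (X m) (d m)) p) =
      ereal_powr (ereal (if m = n then 0 else D m)) p" for m
    by (cases "m = n") (simp_all add: assms ereal_powr_def)
  then show ?thesis
    unfolding lp_norm_def
    by (simp only: suminf_ereal_powr[OF summable_remaining] ereal_powr_ereal[of _ "1 / p"])
qed

end

lemma lp_factorsI:
  assumes "1 \<le> p" "\<And>n. Metric_space (X n) (d n)" "\<And>n. X n \<noteq> {}"
    and "\<And>n. ediam (X n) (d n) = ereal (D n)" "summable (\<lambda>n. D n powr p)"
  shows "lp_factors p X d D"
proof
  show "d n a b \<le> D n" if "a \<in> X n" "b \<in> X n" for n a b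
    using dist_le_ediam[OF that, of "d n"] assms(4) by simp
qed (simp_all add: assms Metric_space.nonneg[OF assms(2)])

text \<open>A correspondence of the products is projected to the \<open>n\<close>-th coordinates.  The argument is by
  contradiction, with a real \<open>c\<close> strictly between the two sides, because the distance of the
  products is an extended real; such a \<open>c\<close> yields a correspondence of distortion at most
  \<open>2 * c\<close>.\<close>

lemma GH_dist_factor_le:
  assumes "lp_factors p X dX A" "lp_factors p Y dY B"
  shows "GH_dist (X n) (dX n) (Y n) (dY n)
      - ereal (1/2) * ereal (lp_norm p (\<lambda>m. if m = n then 0 else A m))
      - ereal (1/2) * ereal (lp_norm p (\<lambda>m. if m = n then 0 else B m))
    \<le> GH_dist (lp_carrier X) (lp_dist p dX) (lp_carrier Y) (lp_dist p dY)"
    (is "?L \<le> ?G")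
proof (rule ccontr)
  interpret X: lp_factors p X dX A by fact
  interpret Y: lp_factors p Y dY B by fact
  define a where "a = lp_norm p (\<lambda>m. if m = n then 0 else A m)"
  define b where "b = lp_norm p (\<lambda>m. if m = n then 0 else B m)"
  note remaining = a_def[symmetric] b_def[symmetric]
  assume "\<not> ?L \<le> ?G"
  then obtain c where c: "?G < ereal c" "ereal c < ?L"
    using ereal_dense2[of ?G ?L] by (meson not_le)
  obtain R where R: "R \<in> correspondences (lp_carrier X) (lp_carrier Y)"
    and dis: "\<And>x y x' y'. (x, y) \<in> R \<Longrightarrow> (x', y') \<in> R \<Longrightarrow>
      \<bar>lp_dist p dX x x' - lp_dist p dY y y'\<bar> \<le> 2 * c"
    using GH_dist_lessE[OF c(1)] by blast
  have "GH_dist (X n) (dX n) (Y n) (dY n) \<le> ereal (c + a / 2 + b / 2)"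
  proof (rule GH_dist_leI[OF correspondence_project[OF X.nonempty Y.nonempty R]])
    fix u v u' v'
    assume "(u, v) \<in> (\<lambda>(x, y). (x n, y n)) ` R" "(u', v') \<in> (\<lambda>(x, y). (x n, y n)) ` R"
    then obtain x y x' y' where in_R: "(x, y) \<in> R" "(x', y') \<in> R"
      and uv: "u = x n" "v = y n" "u' = x' n" "v' = y' n"
      by auto
    then have in_X: "x \<in> lp_carrier X" "x' \<in> lp_carrier X"
      and in_Y: "y \<in> lp_carrier Y" "y' \<in> lp_carrier Y"
      using R by (auto simp: correspondences_def)
    have "0 \<le> a" "0 \<le> b" by (simp_all add: a_def b_def)
    then show "\<bar>dX n u u' - dY n v v'\<bar> \<le> 2 * (c + a / 2 + b / 2)"
      using dis[OF in_R] X.coordinate_le_lp_dist[OF in_X, of n]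
        X.lp_dist_le_coordinate_plus[OF in_X, of n] Y.coordinate_le_lp_dist[OF in_Y, of n]
        Y.lp_dist_le_coordinate_plus[OF in_Y, of n]
      unfolding uv remaining abs_le_iff by (simp add: algebra_simps)
  qed
  then show False
    using c(2) unfolding remaining by (cases "GH_dist (X n) (dX n) (Y n) (dY n)") auto
qed

text \<open>Near-optimal correspondences of the factors are multiplied.  Their errors must form a
  sequence of arbitrarily small \<open>l\<^sup>p\<close>-norm; multiples of a geometric sequence serve.\<close>

lemma GH_dist_product_le:
  assumes "lp_factors p X dX A" "lp_factors p Y dY B"
    and g: "\<And>n. GH_dist (X n) (dX n) (Y n) (dY n) = ereal (g n)" "\<And>n. 0 \<le> g n"
      "summable (\<lambda>n. g n powr p)"
  shows "GH_dist (lp_carrier X) (lp_dist p dX) (lp_carrier Y) (lp_dist p dY)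
    \<le> ereal (lp_norm p g)"
proof (rule ereal_le_epsilon2)
  interpret X: lp_factors p X dX A by fact
  interpret Y: lp_factors p Y dY B by fact
  note p = X.p
  define h :: "nat \<Rightarrow> real" where "h n = (1/2) ^ n" for n
  have h: "summable (\<lambda>n. h n powr p)" "\<And>n. 0 < h n"
  proof -
    show pos: "0 < h n" for n by (simp add: h_def)
    have "norm (h n powr p) \<le> h n" for n
      using powr_mono'[of 1 p "h n"] p pos[of n] by (simp add: h_def power_le_one)
    moreover have "summable h"
      unfolding h_def by (rule summable_geometric) simp
    ultimately show "summable (\<lambda>n. h n powr p)"
      by (rule summable_comparison_test'[rotated])
  qed
  fix \<epsilon> :: real
  assume "0 < \<epsilon>"
  \<comment> \<open>the \<open>+ 1\<close> only spares a proof that the norm of \<open>h\<close> is not zero\<close>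
  define \<delta> where "\<delta> = \<epsilon> / (lp_norm p h + 1)"
  have \<delta>: "0 < \<delta>" "\<delta> * lp_norm p h \<le> \<epsilon>"
  proof -
    have "0 < lp_norm p h + 1"
      using lp_norm_nonneg[of p h] by linarith
    then show "0 < \<delta>" "\<delta> * lp_norm p h \<le> \<epsilon>"
      using \<open>0 < \<epsilon>\<close> by (simp_all add: \<delta>_def pos_divide_le_eq)
  qed
  define r where "r n = g n + \<delta> * h n" for n
  have "GH_dist (X n) (dX n) (Y n) (dY n) < ereal (r n)" for n
    using \<delta> h by (simp add: g r_def)
  then have "\<exists>R. R \<in> correspondences (X n) (Y n) \<and> (\<forall>a b a' b'. (a, b) \<in> R \<longrightarrow>
      (a', b') \<in> R \<longrightarrow> \<bar>dX n a a' - dY n b b'\<bar> \<le> 2 * r n)" for n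
    by (rule GH_dist_lessE) blast
  then obtain R where R: "\<And>n. R n \<in> correspondences (X n) (Y n)"
    and dis: "\<And>n a b a' b'. (a, b) \<in> R n \<Longrightarrow> (a', b') \<in> R n \<Longrightarrow>
      \<bar>dX n a a' - dY n b b'\<bar> \<le> 2 * r n"
    by metis
  note scale_h = lp_norm_scale[OF p less_imp_le[OF \<delta>(1)] less_imp_le[OF h(2)] h(1)]
  have nonneg: "0 \<le> \<delta> * h n" "0 \<le> r n" for n
    using g(2) h(2) \<delta>(1) by (auto simp: r_def less_imp_le)
  have summable_r: "summable (\<lambda>n. r n powr p)"
    unfolding r_def by (rule minkowski_lp_norm[OF p g(2,3) nonneg(1) scale_h(1)])
  have "lp_norm p r \<le> lp_norm p g + lp_norm p (\<lambda>n. \<delta> * h n)"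
    unfolding r_def by (rule minkowski_lp_norm[OF p g(2,3) nonneg(1) scale_h(1)])
  then have norm_r: "lp_norm p r \<le> lp_norm p g + \<epsilon>"
    using scale_h(2) \<delta>(2) by simp
  note scale_r = lp_norm_scale[OF p _ nonneg(2) summable_r, of 2, simplified]
  let ?P = "{(x, y). \<forall>n. (x n, y n) \<in> R n}"
  have P: "?P \<in> correspondences (lp_carrier X) (lp_carrier Y)"
    by (rule correspondence_product[OF R])
  have "GH_dist (lp_carrier X) (lp_dist p dX) (lp_carrier Y) (lp_dist p dY)
      \<le> ereal (lp_norm p r)"
  proof (rule GH_dist_leI[OF P])
    fix x y x' y'
    assume in_P: "(x, y) \<in> ?P" "(x', y') \<in> ?P"
    then have in_X: "x \<in> lp_carrier X" "x' \<in> lp_carrier X"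
      and in_Y: "y \<in> lp_carrier Y" "y' \<in> lp_carrier Y"
      using P by (auto simp: correspondences_def)
    have close: "\<bar>dX n (x n) (x' n) - dY n (y n) (y' n)\<bar> \<le> 2 * r n" for n
      using in_P by (intro dis) auto
    have "lp_dist p dX x x' \<le> lp_dist p dY y y' + lp_norm p (\<lambda>n. 2 * r n)"
      unfolding lp_dist_eq_lp_norm
    proof (rule lp_norm_triangle_le[OF p Y.dist_nonneg Y.summable_lp_dist[OF in_Y] _ scale_r(1)])
      show "dX n (x n) (x' n) \<le> dY n (y n) (y' n) + 2 * r n" for n
        using close[of n] by simp
    qed (use nonneg X.dist_nonneg in auto)
    moreover have "lp_dist p dY y y' \<le> lp_dist p dX x x' + lp_norm p (\<lambda>n. 2 * r n)"
      unfolding lp_dist_eq_lp_norm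
    proof (rule lp_norm_triangle_le[OF p X.dist_nonneg X.summable_lp_dist[OF in_X] _ scale_r(1)])
      show "dY n (y n) (y' n) \<le> dX n (x n) (x' n) + 2 * r n" for n
        using close[of n] by simp
    qed (use nonneg Y.dist_nonneg in auto)
    ultimately show "\<bar>lp_dist p dX x x' - lp_dist p dY y y'\<bar> \<le> 2 * lp_norm p r"
      using scale_r(2) by simp
  qed
  also have "\<dots> \<le> ereal (lp_norm p g) + ereal \<epsilon>"
    using norm_r by simp
  finally show "GH_dist (lp_carrier X) (lp_dist p dX) (lp_carrier Y) (lp_dist p dY)
      \<le> ereal (lp_norm p g) + ereal \<epsilon>" .
qed

section \<open>Gromov--Hausdorff distance between products\<close>

theorem theorem2p7:
  fixes p :: real
    and X :: "nat \<Rightarrow> 'a set" and dX :: "nat \<Rightarrow> 'a \<Rightarrow> 'a \<Rightarrow> real"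
    and Y :: "nat \<Rightarrow> 'b set" and dY :: "nat \<Rightarrow> 'b \<Rightarrow> 'b \<Rightarrow> real"
  assumes "1 \<le> p"
    and "\<And>n. Metric_space (X n) (dX n)" and "\<And>n. X n \<noteq> {}"
    and "\<And>n. Metric_space (Y n) (dY n)" and "\<And>n. Y n \<noteq> {}"
    and "(\<Sum>n. ereal_powr (ediam (X n) (dX n)) p) < \<infinity>"
    and "(\<Sum>n. ereal_powr (ediam (Y n) (dY n)) p) < \<infinity>"
  shows "(SUP n. GH_dist (X n) (dX n) (Y n) (dY n)
            - ereal (1/2) * ereal_powr
                (\<Sum>m. if m = n then 0 else ereal_powr (ediam (X m) (dX m)) p) (1 / p)
            - ereal (1/2) * ereal_powr
                (\<Sum>m. if m = n then 0 else ereal_powr (ediam (Y m) (dY m)) p) (1 / p))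
          \<le> GH_dist (lp_carrier X) (lp_dist p dX) (lp_carrier Y) (lp_dist p dY)
       \<and> GH_dist (lp_carrier X) (lp_dist p dX) (lp_carrier Y) (lp_dist p dY)
          \<le> ereal_powr (\<Sum>n. ereal_powr (GH_dist (X n) (dX n) (Y n) (dY n)) p) (1 / p)"
proof
  obtain A where A: "\<And>n. ediam (X n) (dX n) = ereal (A n)" "summable (\<lambda>n. A n powr p)"
    by (rule finite_ereal_powr_seriesE[OF ediam_nonneg[OF assms(2,3)] assms(6)]) (rule that)
  obtain B where B: "\<And>n. ediam (Y n) (dY n) = ereal (B n)" "summable (\<lambda>n. B n powr p)"
    by (rule finite_ereal_powr_seriesE[OF ediam_nonneg[OF assms(4,5)] assms(7)]) (rule that)
  have X: "lp_factors p X dX A"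
    using assms(1-3) A by (rule lp_factorsI)
  have Y: "lp_factors p Y dY B"
    using assms(1,4,5) B by (rule lp_factorsI)
  show "(SUP n. GH_dist (X n) (dX n) (Y n) (dY n)
      - ereal (1/2) * ereal_powr
          (\<Sum>m. if m = n then 0 else ereal_powr (ediam (X m) (dX m)) p) (1 / p)
      - ereal (1/2) * ereal_powr
          (\<Sum>m. if m = n then 0 else ereal_powr (ediam (Y m) (dY m)) p) (1 / p))
    \<le> GH_dist (lp_carrier X) (lp_dist p dX) (lp_carrier Y) (lp_dist p dY)"
    unfolding lp_factors.suminf_remaining[OF X A(1)] lp_factors.suminf_remaining[OF Y B(1)]
    by (rule SUP_least) (rule GH_dist_factor_le[OF X Y])
  show "GH_dist (lp_carrier X) (lp_dist p dX) (lp_carrier Y) (lp_dist p dY)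
    \<le> ereal_powr (\<Sum>n. ereal_powr (GH_dist (X n) (dX n) (Y n) (dY n)) p) (1 / p)"
  proof (cases "(\<Sum>n. ereal_powr (GH_dist (X n) (dX n) (Y n) (dY n)) p) < \<infinity>")
    case True
    obtain g where g: "\<And>n. GH_dist (X n) (dX n) (Y n) (dY n) = ereal (g n)"
      "\<And>n. 0 \<le> g n" "summable (\<lambda>n. g n powr p)"
      by (rule finite_ereal_powr_seriesE[OF GH_dist_nonneg[OF assms(3)] True]) (rule that)
    have "ereal_powr (\<Sum>n. ereal_powr (GH_dist (X n) (dX n) (Y n) (dY n)) p) (1 / p) =
        ereal (lp_norm p g)"
      unfolding g(1) suminf_ereal_powr[OF g(3)] by (simp add: lp_norm_def)
    then show ?thesis
      using GH_dist_product_le[OF X Y g] by simp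
  next
    case False
    then have "(\<Sum>n. ereal_powr (GH_dist (X n) (dX n) (Y n) (dY n)) p) = \<infinity>"
      by simp
    then show ?thesis by (simp only: ereal_powr_infinity ereal_less_eq(1))
  qed
qed

end
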